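(* Let $R$ be a uniform $L$-layered $1$-semifield$^\dagger$, and let $f,g\in R[\lambda]$ be monic polynomials with primary decompositions $f=\prod_a f_a$ and $g=\prod_b g_b$. Then $$|\Re(f,g)|=\prod_{a,b}|\Re(f_a,g_b)|.$$
   Context: Concretely, $R=R(L,\mathcal{G})$ with $L$ a totally ordered commutative semiring$^\dagger$ (semiring without necessarily a zero) and $\mathcal{G}$ a totally ordered abelian group; elements $x^{[\ell]}$ ($x\in\mathcal{G}$, layer $\ell$), $x^{[k]}y^{[\ell]}=(xy)^{[k\ell]}$, $x^{[k]}+y^{[\ell]}$ equal to $x^{[k]}$ if $x>y$, $y^{[\ell]}$ if $x<y$, $x^{[k+\ell]}$ if $x=y$; a zero element $\mathbb{0}_R$ is formally adjoined; $u\cong_\nu v$ means equal $\mathcal{G}$-values. A polynomial of degree $t$ is monic if its leading coefficient is $\cong_\nu\mathbb{1}_R$; a monic $f$ of degree $t$ is $a$-primary if $f=\lambda^t+\sum_j\alpha_j\lambda^{i_j}$ with $\alpha_j\cong_\nu a^{t-i_j}$. A primary decomposition of a monic $f$ is a factorization $f=\prod_a f_a$ in $R[\lambda]$ where each $f_a$ is $a$-primary and the $a$'s are pairwise $\nu$-inequivalent (the corner roots of $f$). The layered permanent of an $N\times N$ matrix is $|A|=\sum_{\sigma\in S_N}\prod_i a_{i,\sigma(i)}$. For $f=\sum_{i=0}^m\alpha_i\lambda^i$, $A_n(f)$ is the $n\times(m+n)$ matrix whose $r$-th row is $(\mathbb{0},\dots,\mathbb{0},\alpha_0,\dots,\alpha_m,\mathbb{0},\dots)$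 with $r-1$ leading zeros; the Sylvester matrix is $\Re(f,g)=\binom{A_n(f)}{A_m(g)}$, and the layered resultant is $|\Re(f,g)|$. *)

theory Defs
  imports "HOL-Computational_Algebra.Polynomial" "HOL-Combinatorics.Permutations"
begin

text \<open>The uniform layered semiring R(L,G) with a formally adjoined zero.
  The totally ordered abelian group G is written additively (type class
  linordered_ab_group_add), so x^[k] * y^[l] = (x+y)^[k*l] and 1_R = 0^[1].
  L is a commutative semiring with 1 but without necessarily a zero.\<close>

datatype ('g, 'l) layered = LZero | Lay 'g 'l

instantiation layered :: (linordered_ab_group_add, "{comm_semiring, monoid_mult}") comm_semiring_1
begin

definition zero_layered :: "('a, 'b) layered" where "zero_layered = LZero"

definition one_layered :: "('a, 'b) layered" where "one_layered = Lay 0 1"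

fun plus_layered :: "('a, 'b) layered \<Rightarrow> ('a, 'b) layered \<Rightarrow> ('a, 'b) layered" where
  "plus_layered LZero y = y"
| "plus_layered (Lay x k) LZero = Lay x k"
| "plus_layered (Lay x k) (Lay y l) =
     (if y < x then Lay x k else if x < y then Lay y l else Lay x (k + l))"

fun times_layered :: "('a, 'b) layered \<Rightarrow> ('a, 'b) layered \<Rightarrow> ('a, 'b) layered" where
  "times_layered LZero y = LZero"
| "times_layered (Lay x k) LZero = LZero"
| "times_layered (Lay x k) (Lay y l) = Lay (x + y) (k * l)"

instance
proof
  fix a b c :: "('a, 'b) layered"
  show "a + b + c = a + (b + c)"
    by (cases a; cases b; cases c) (auto simp: add.assoc)
  show "a + b = b + a"
    by (cases a; cases b) (auto simp: add.commute)
  show "0 + a = a" by (simp add: zero_layered_def)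
  show "a * b * c = a * (b * c)"
    by (cases a; cases b; cases c) (auto simp: add.assoc mult.assoc)
  show "a * b = b * a"
    by (cases a; cases b) (auto simp: add.commute mult.commute)
  show "1 * a = a" by (cases a) (auto simp: one_layered_def)
  show "(a + b) * c = a * c + b * c"
    by (cases a; cases b; cases c) (auto simp: distrib_right)
  show "0 * a = 0" by (simp add: zero_layered_def)
  show "a * 0 = 0" by (cases a) (auto simp: zero_layered_def)
  show "(0::('a, 'b) layered) \<noteq> 1" by (simp add: zero_layered_def one_layered_def)
qed

end

fun nu_eq :: "('g, 'l) layered \<Rightarrow> ('g, 'l) layered \<Rightarrow> bool" where
  "nu_eq LZero LZero = True"
| "nu_eq (Lay x k) (Lay y l) = (x = y)"
| "nu_eq _ _ = False"

definition monic :: "('g::linordered_ab_group_add, 'l::{comm_semiring, monoid_mult}) layered poly \<Rightarrow> bool" where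
  "monic f \<longleftrightarrow> nu_eq (lead_coeff f) 1"

definition primary :: "('g::linordered_ab_group_add, 'l::{comm_semiring, monoid_mult}) layered
     \<Rightarrow> ('g, 'l) layered poly \<Rightarrow> bool" where
  "primary a f \<longleftrightarrow> monic f \<and>
     (\<forall>i\<le>degree f. coeff f i \<noteq> 0 \<longrightarrow> nu_eq (coeff f i) (a ^ (degree f - i)))"

definition primary_decomposition :: "('g::linordered_ab_group_add, 'l::{comm_semiring, monoid_mult}) layered poly
     \<Rightarrow> (('g, 'l) layered \<times> ('g, 'l) layered poly) list \<Rightarrow> bool" where
  "primary_decomposition f D \<longleftrightarrow>
     (\<forall>(a, fa) \<in> set D. a \<noteq> 0 \<and> primary a fa) \<and>
     (\<forall>i<length D. \<forall>j<length D. i \<noteq> j \<longrightarrow> \<not> nu_eq (fst (D ! i)) (fst (D ! j))) \<and>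
     f = prod_list (map snd D)"

definition lperm :: "nat \<Rightarrow> (nat \<Rightarrow> nat \<Rightarrow> 'a::comm_semiring_1) \<Rightarrow> 'a" where
  "lperm N A = (\<Sum>\<sigma> \<in> {\<sigma>. \<sigma> permutes {..<N}}. \<Prod>i<N. A i (\<sigma> i))"

definition sylvester :: "'a::comm_semiring_1 poly \<Rightarrow> 'a poly \<Rightarrow> nat \<Rightarrow> nat \<Rightarrow> 'a" where
  "sylvester f g r c =
     (if r < degree g then (if r \<le> c then coeff f (c - r) else 0)
      else (if r - degree g \<le> c then coeff g (c - (r - degree g)) else 0))"

definition lresultant :: "'a::comm_semiring_1 poly \<Rightarrow> 'a poly \<Rightarrow> 'a" where
  "lresultant f g = lperm (degree f + degree g) (sylvester f g)"

end

theory Submission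
  imports Defs
begin

text \<open>
  Give each row and each column of the Sylvester matrix of \<open>f\<close> and \<open>g\<close> a potential in \<open>\<G>\<close>: if \<open>F\<close> and
  \<open>G\<close> are the Newton polygons of \<open>f\<close> and \<open>g\<close>, and \<open>H\<close> that of \<open>f g\<close>, then column \<open>c\<close> gets \<open>H c\<close>, the
  \<open>r\<close>-th row of \<open>f\<close> gets \<open>- G r\<close> and the \<open>r\<close>-th row of \<open>g\<close> gets \<open>- F r\<close>. No entry has a value above the sum of
  its two potentials, so the part of the permanent of maximal possible value is the permanent of the
  matrix of those entries that attain the bound. When the roots of \<open>p\<close> and \<open>q\<close> all have value \<open>a\<close> and those of \<open>f\<close> and
  \<open>g\<close> have larger values, this matrix for \<open>p f\<close> and \<open>q g\<close> is, after a permutation of the rows, block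
  triangular, with diagonal blocks that are row multiples of the matrices of \<open>p, q\<close> and of \<open>f, g\<close>. The
  theorem follows by removing the smallest root repeatedly; powers of the variable, which
  correspond to a root at the adjoined zero, are split off separately.
\<close>

subsection \<open>Permanents\<close>

text \<open>Any index set is allowed, so that a diagonal block is a permanent before its rows and
  columns are renumbered.\<close>

definition set_perm :: "nat set \<Rightarrow> (nat \<Rightarrow> nat \<Rightarrow> 'a::comm_semiring_1) \<Rightarrow> 'a" where
  "set_perm S A = (\<Sum>\<sigma> | \<sigma> permutes S. \<Prod>i\<in>S. A i (\<sigma> i))"

lemma lperm_eq_set_perm: "lperm N A = set_perm {..<N} A"
  by (simp add: lperm_def set_perm_def)

text \<open>An injective map of the finite set \<open>S\<close> into itself is onto, so the image of
  \<open>T\<close> can only be \<open>T\<close>.\<close>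

lemma permutes_Un_decompose:
  assumes \<sigma>: "\<sigma> permutes S \<union> T" and disj: "S \<inter> T = {}" and fin: "finite S"
    and maps: "\<And>i. i \<in> S \<Longrightarrow> \<sigma> i \<in> S"
  shows "(\<lambda>i. if i \<in> S then \<sigma> i else i) permutes S" "(\<lambda>i. if i \<in> T then \<sigma> i else i) permutes T"
proof -
  have inj: "inj \<sigma>" using \<sigma> by (rule permutes_inj)
  have S: "\<sigma> ` S = S"
    using maps fin inj by (intro endo_inj_surj) (auto intro: inj_on_subset)
  have ST: "\<sigma> ` (S \<union> T) = S \<union> T" using \<sigma> by (rule permutes_image)
  have "\<sigma> ` T = \<sigma> ` (S \<union> T) - \<sigma> ` S"
    using inj disj by (auto simp: inj_def)
  then have T: "\<sigma> ` T = T" using S ST disj by auto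
  have eq: "bij_betw (\<lambda>i. if i \<in> X then \<sigma> i else i) X X \<longleftrightarrow> bij_betw \<sigma> X X" for X
    by (rule bij_betw_cong) simp
  have "bij_betw \<sigma> S S" "bij_betw \<sigma> T T"
    using S T inj by (auto simp: bij_betw_def intro: inj_on_subset)
  then show "(\<lambda>i. if i \<in> S then \<sigma> i else i) permutes S" "(\<lambda>i. if i \<in> T then \<sigma> i else i) permutes T"
    by (auto intro!: bij_imp_permutes simp: eq)
qed

text \<open>A permutation that takes some index of \<open>S\<close> into \<open>T\<close> meets a
  zero entry; the remaining ones are pairs of permutations of \<open>S\<close> and of
  \<open>T\<close>.\<close>

lemma set_perm_Un:
  assumes fin: "finite S" "finite T" and disj: "S \<inter> T = {}"
    and zero: "\<And>r c. r \<in> S \<Longrightarrow> c \<in> T \<Longrightarrow> A r c = 0"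
  shows "set_perm (S \<union> T) A = set_perm S A * set_perm T A"
proof -
  let ?P = "\<lambda>X. {\<sigma>. \<sigma> permutes X}"
  let ?Q = "{\<sigma>. \<sigma> permutes S \<union> T \<and> (\<forall>i\<in>S. \<sigma> i \<in> S)}"
  have "set_perm (S \<union> T) A = (\<Sum>\<sigma>\<in>?Q. \<Prod>i\<in>S \<union> T. A i (\<sigma> i))"
    unfolding set_perm_def
  proof (rule sum.mono_neutral_right)
    show "finite (?P (S \<union> T))" using fin by (simp add: finite_permutations)
    show "\<forall>\<sigma>\<in>?P (S \<union> T) - ?Q. (\<Prod>i\<in>S \<union> T. A i (\<sigma> i)) = 0"
    proof
      fix \<sigma> assume "\<sigma> \<in> ?P (S \<union> T) - ?Q"
      then obtain i where p: "\<sigma> permutes S \<union> T" and i: "i \<in> S" "\<sigma> i \<notin> S" by auto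
      have "\<sigma> i \<in> S \<union> T" using permutes_in_image[OF p] i by blast
      then have "A i (\<sigma> i) = 0" using zero i by auto
      then show "(\<Prod>i\<in>S \<union> T. A i (\<sigma> i)) = 0"
        using fin i by (intro prod_zero) auto
    qed
  qed auto
  also have "\<dots> = (\<Sum>(\<rho>, \<tau>)\<in>?P S \<times> ?P T. (\<Prod>i\<in>S. A i (\<rho> i)) * (\<Prod>i\<in>T. A i (\<tau> i)))"
  proof (rule sum.reindex_bij_witness[where
        i = "\<lambda>(\<rho>, \<tau>). \<rho> \<circ> \<tau>" and
        j = "\<lambda>\<sigma>. (\<lambda>i. if i \<in> S then \<sigma> i else i, \<lambda>i. if i \<in> T then \<sigma> i else i)"])
    fix \<sigma> assume "\<sigma> \<in> ?Q"
    then have \<sigma>: "\<sigma> permutes S \<union> T" and maps: "\<And>i. i \<in> S \<Longrightarrow> \<sigma> i \<in> S" by auto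
    note dec = permutes_Un_decompose[OF \<sigma> disj fin(1) maps]
    show "(\<lambda>i. if i \<in> S then \<sigma> i else i, \<lambda>i. if i \<in> T then \<sigma> i else i) \<in> ?P S \<times> ?P T"
      using dec by simp
    have T: "\<sigma> i \<in> T" if "i \<in> T" for i
      using permutes_in_image[OF dec(2), of i] that by simp
    show "(case (\<lambda>i. if i \<in> S then \<sigma> i else i, \<lambda>i. if i \<in> T then \<sigma> i else i) of
            (\<rho>, \<tau>) \<Rightarrow> \<rho> \<circ> \<tau>) = \<sigma>"
    proof
      fix i
      consider "i \<in> S" "i \<notin> T" | "i \<in> T" "\<sigma> i \<in> T" "\<sigma> i \<notin> S" | "i \<notin> S" "i \<notin> T"
        using disj T by blast
      then show "(case (\<lambda>i. if i \<in> S then \<sigma> i else i, \<lambda>i. if i \<in> T then \<sigma> i else i) of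
            (\<rho>, \<tau>) \<Rightarrow> \<rho> \<circ> \<tau>) i = \<sigma> i"
        using permutes_not_in[OF \<sigma>, of i] by cases auto
    qed
    have "(\<Prod>i\<in>S \<union> T. A i (\<sigma> i)) = (\<Prod>i\<in>S. A i (\<sigma> i)) * (\<Prod>i\<in>T. A i (\<sigma> i))"
      using fin disj by (simp add: prod.union_disjoint)
    then show "(case (\<lambda>i. if i \<in> S then \<sigma> i else i, \<lambda>i. if i \<in> T then \<sigma> i else i) of
            (\<rho>, \<tau>) \<Rightarrow> (\<Prod>i\<in>S. A i (\<rho> i)) * (\<Prod>i\<in>T. A i (\<tau> i))) = (\<Prod>i\<in>S \<union> T. A i (\<sigma> i))"
      by simp
  next
    fix b assume "b \<in> ?P S \<times> ?P T"
    then obtain \<rho> \<tau> where b: "b = (\<rho>, \<tau>)" and \<rho>: "\<rho> permutes S" and \<tau>: "\<tau> permutes T" by auto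
    have S: "\<tau> i = i" "\<rho> i \<in> S" if "i \<in> S" for i
      using permutes_not_in[OF \<tau>, of i] permutes_in_image[OF \<rho>] that disj by auto
    have T: "\<rho> (\<tau> i) = \<tau> i" if "i \<in> T" for i
      using permutes_not_in[OF \<rho>, of "\<tau> i"] permutes_in_image[OF \<tau>, of i] that disj by auto
    show "(case b of (\<rho>, \<tau>) \<Rightarrow> \<rho> \<circ> \<tau>) \<in> ?Q"
      using b S permutes_compose[OF permutes_subset[OF \<tau>] permutes_subset[OF \<rho>], of "S \<union> T"]
      by auto
    show "(\<lambda>i. if i \<in> S then (case b of (\<rho>, \<tau>) \<Rightarrow> \<rho> \<circ> \<tau>) i else i,
           \<lambda>i. if i \<in> T then (case b of (\<rho>, \<tau>) \<Rightarrow> \<rho> \<circ> \<tau>) i else i) = b"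
      using b S T permutes_not_in[OF \<rho>] permutes_not_in[OF \<tau>] by (auto simp: fun_eq_iff)
  qed
  also have "\<dots> = set_perm S A * set_perm T A"
    unfolding set_perm_def by (simp add: sum.cartesian_product sum_product)
  finally show ?thesis .
qed

lemma set_perm_shift: "set_perm {k..<k + l} A = lperm l (\<lambda>r c. A (k + r) (k + c))"
proof -
  \<comment> \<open>Conjugation by the translation by \<open>k\<close>, in the form given by
    \<open>bij_betw_permutations\<close>.\<close>
  let ?h = "\<lambda>\<pi> x. if x \<in> {k..<k + l} then k + \<pi> (inv_into {..<l} ((+) k) x) else x"
  have bij: "bij_betw ((+) k) {..<l} {k..<k + l}"
    by (rule bij_betw_byWitness[where f' = "\<lambda>x. x - k"]) auto
  have h: "bij_betw ?h {\<pi>. \<pi> permutes {..<l}} {\<pi>. \<pi> permutes {k..<k + l}}"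
    using bij_betw_permutations[OF bij] by simp
  have "(\<Prod>i\<in>{k..<k + l}. A i (?h \<sigma> i)) = (\<Prod>i<l. A (k + i) (k + \<sigma> i))" for \<sigma>
  proof -
    have "(\<Prod>i\<in>{k..<k + l}. A i (?h \<sigma> i)) = (\<Prod>i<l. A (k + i) (?h \<sigma> (k + i)))"
      by (rule prod.reindex_bij_betw[OF bij, symmetric])
    also have "\<dots> = (\<Prod>i<l. A (k + i) (k + \<sigma> i))"
      using bij by (intro prod.cong) (auto simp: bij_betw_def inv_into_f_f)
    finally show ?thesis .
  qed
  then show ?thesis
    unfolding set_perm_def lperm_def
    by (subst sum.reindex_bij_betw[OF h, symmetric]) simp
qed

lemma lperm_lower_block:
  assumes "\<And>r c. r < k \<Longrightarrow> k \<le> c \<Longrightarrow> c < k + l \<Longrightarrow> A r c = 0"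
  shows "lperm (k + l) A = lperm k A * lperm l (\<lambda>r c. A (k + r) (k + c))"
proof -
  have "{..<k + l} = {..<k} \<union> {k..<k + l}" by auto
  moreover have "set_perm ({..<k} \<union> {k..<k + l}) A = set_perm {..<k} A * set_perm {k..<k + l} A"
    by (rule set_perm_Un) (use assms in auto)
  ultimately show ?thesis
    by (simp add: lperm_eq_set_perm[of "k + l"] lperm_eq_set_perm[of k] set_perm_shift)
qed

lemma lperm_upper_block:
  assumes "\<And>r c. c < k \<Longrightarrow> k \<le> r \<Longrightarrow> r < k + l \<Longrightarrow> A r c = 0"
  shows "lperm (k + l) A = lperm k A * lperm l (\<lambda>r c. A (k + r) (k + c))"
proof -
  \<comment> \<open>The later rows now play the part of \<open>S\<close>, since it is their entries
    in the earlier columns that vanish.\<close>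
  have "{..<k + l} = {k..<k + l} \<union> {..<k}" by auto
  moreover have "set_perm ({k..<k + l} \<union> {..<k}) A = set_perm {k..<k + l} A * set_perm {..<k} A"
    by (rule set_perm_Un) (use assms in auto)
  ultimately show ?thesis
    by (simp add: lperm_eq_set_perm[of "k + l"] lperm_eq_set_perm[of k] set_perm_shift mult.commute)
qed

lemma lperm_cong:
  assumes "\<And>r c. r < N \<Longrightarrow> c < N \<Longrightarrow> A r c = B r c"
  shows "lperm N A = lperm N B"
  unfolding lperm_def
  using assms permutes_in_image[of _ "{..<N}"] by (intro sum.cong prod.cong) auto

lemma lperm_permute_rows:
  assumes \<pi>: "\<pi> permutes {..<N}"
  shows "lperm N (\<lambda>r. A (\<pi> r)) = lperm N A"
proof -
  have "lperm N (\<lambda>r. A (\<pi> r)) = (\<Sum>\<sigma> | \<sigma> permutes {..<N}. \<Prod>i<N. A (\<pi> i) ((\<sigma> \<circ> \<pi>) i))"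
    unfolding lperm_def by (rule sum_permutations_compose_right[OF \<pi>])
  also have "\<dots> = lperm N A"
    unfolding lperm_def
  proof (rule sum.cong)
    fix \<sigma>
    show "(\<Prod>i<N. A (\<pi> i) ((\<sigma> \<circ> \<pi>) i)) = (\<Prod>i<N. A i (\<sigma> i))"
      using prod.permute[OF \<pi>, of "\<lambda>i. A i (\<sigma> i)"] by (simp add: o_def)
  qed simp
  finally show ?thesis .
qed

lemma lperm_scale_rows: "lperm N (\<lambda>r c. d r * A r c) = (\<Prod>r<N. d r) * lperm N A"
  by (simp add: lperm_def prod.distrib sum_distrib_left)

text \<open>Exchanges the adjacent segments of lengths \<open>b\<close> and \<open>c\<close> that
  begin at \<open>a\<close>; interchanging \<open>b\<close> and \<open>c\<close> gives the
  inverse.\<close>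

definition swap_segments :: "nat \<Rightarrow> nat \<Rightarrow> nat \<Rightarrow> nat \<Rightarrow> nat" where
  "swap_segments a b c i =
     (if i < a then i else if i < a + b then i + c else if i < a + b + c then i - b else i)"

lemma swap_segments_permutes:
  assumes "a + b + c \<le> N"
  shows "swap_segments a b c permutes {..<N}"
proof (rule bij_imp_permutes)
  show "bij_betw (swap_segments a b c) {..<N} {..<N}"
    by (rule bij_betw_byWitness[where f' = "swap_segments a c b"])
      (use assms in \<open>auto simp: swap_segments_def\<close>)
qed (use assms in \<open>auto simp: swap_segments_def\<close>)

subsection \<open>Resultants over a commutative semiring\<close>

text \<open>Moving one block of rows past the other costs no sign in a permanent.\<close>

lemma lresultant_commute: "lresultant f g = lresultant g f"
proof -
  let ?m = "degree f" and ?n = "degree g"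
  have "lresultant g f = lperm (?m + ?n) (\<lambda>r. sylvester f g (swap_segments 0 ?m ?n r))"
    unfolding lresultant_def
    by (subst add.commute, rule lperm_cong) (auto simp: sylvester_def swap_segments_def)
  also have "\<dots> = lresultant f g"
    unfolding lresultant_def by (intro lperm_permute_rows swap_segments_permutes) simp
  finally show ?thesis ..
qed

text \<open>Expansion along column 0, where only the top row can have a nonzero entry, namely
  \<open>coeff g 0\<close>.\<close>

lemma lresultant_pCons_right:
  assumes "f \<noteq> 0"
  shows "lresultant g (pCons 0 f) = coeff g 0 * lresultant g f"
proof -
  let ?A = "sylvester g (pCons 0 f)"
  have deg: "degree g + degree (pCons 0 f) = 1 + (degree g + degree f)"
    using assms by simp
  have "lresultant g (pCons 0 f) =
      lperm 1 ?A * lperm (degree g + degree f) (\<lambda>r c. ?A (1 + r) (1 + c))"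
    unfolding lresultant_def deg
    by (rule lperm_upper_block) (use assms in \<open>auto simp: sylvester_def\<close>)
  also have "lperm 1 ?A = coeff g 0"
    using assms by (simp add: lperm_def sylvester_def lessThan_Suc)
  also have "lperm (degree g + degree f) (\<lambda>r c. ?A (1 + r) (1 + c)) = lresultant g f"
    unfolding lresultant_def
    by (rule lperm_cong)
      (use assms in \<open>auto simp: sylvester_def coeff_pCons Suc_diff_le split: nat.split\<close>)
  finally show ?thesis .
qed

lemma lresultant_pCons_left:
  "f \<noteq> 0 \<Longrightarrow> lresultant (pCons 0 f) g = coeff g 0 * lresultant f g"
  by (simp add: lresultant_commute[of _ g] lresultant_pCons_right)

lemma lresultant_monom_left:
  "f \<noteq> 0 \<Longrightarrow> lresultant (monom 1 k * f) g = coeff g 0 ^ k * lresultant f g"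
proof (induction k)
  case (Suc k)
  have "monom 1 (Suc k) * f = pCons 0 (monom 1 k * f)"
    by (simp add: monom_Suc)
  moreover have "monom 1 k * f \<noteq> 0"
    using Suc.prems coeff_monom_mult[of 1 k f "k + degree f"] by auto
  ultimately show ?case
    using Suc by (simp add: lresultant_pCons_left mult.assoc)
qed simp

subsection \<open>Parts of given value\<close>

text \<open>A pair \<open>Lay x k\<close> is nonzero for every layer \<open>k\<close>, and products
  of pairs are pairs; hence degrees of products add.\<close>

instance layered :: (linordered_ab_group_add, "{comm_semiring, monoid_mult}") semiring_1_no_zero_divisors
proof
  fix x y :: "('a, 'b) layered"
  assume "x \<noteq> 0" "y \<noteq> 0"
  then show "x * y \<noteq> 0"
    by (cases x; cases y) (auto simp: zero_layered_def)
qed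

text \<open>\<open>LZero\<close> obeys every bound, as though its value were minus infinity.\<close>

fun val_le :: "'g::linordered_ab_group_add \<Rightarrow> ('g, 'l) layered \<Rightarrow> bool" where
  "val_le v LZero = True"
| "val_le v (Lay x k) = (x \<le> v)"

fun val_less :: "'g::linordered_ab_group_add \<Rightarrow> ('g, 'l) layered \<Rightarrow> bool" where
  "val_less v LZero = True"
| "val_less v (Lay x k) = (x < v)"

text \<open>On elements bounded by \<open>v\<close> this acts like taking a leading form: it
  respects sums by \<open>part_add\<close> and products by \<open>part_mult\<close>.\<close>

fun part :: "'g::linordered_ab_group_add \<Rightarrow> ('g, 'l) layered \<Rightarrow> ('g, 'l) layered" where
  "part v LZero = LZero"
| "part v (Lay x k) = (if x = v then Lay x k else LZero)"

context
  fixes x y :: "('g::linordered_ab_group_add, 'l::{comm_semiring, monoid_mult}) layered"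
begin

lemma val_0 [simp]: "val_le v (0 :: ('g, 'l) layered)" "val_less v (0 :: ('g, 'l) layered)"
    "part v (0 :: ('g, 'l) layered) = 0"
  by (simp_all add: zero_layered_def)

lemma part_zero_1: "part 0 1 = (1 :: ('g, 'l) layered)"
  by (simp add: one_layered_def)

lemma val_le_zero_1: "val_le 0 (1 :: ('g, 'l) layered)"
  by (simp add: one_layered_def)

lemma val_less_imp_le: "val_less v x \<Longrightarrow> val_le v x"
  by (cases x) auto

lemma val_le_less_trans: "val_le v x \<Longrightarrow> v < w \<Longrightarrow> val_less w x"
  by (cases x) auto

lemma val_le_trans: "val_le v x \<Longrightarrow> v \<le> w \<Longrightarrow> val_le w x"
  by (cases x) auto

lemma part_eq_0: "val_less v x \<Longrightarrow> part v x = 0"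
  by (cases x) (auto simp: zero_layered_def)

text \<open>Turns an identity between parts into one between the elements themselves, once the parts
  are known to be nonzero.\<close>

lemma part_idem: "part v x \<noteq> 0 \<Longrightarrow> part v x = x"
  by (cases x) (auto simp: zero_layered_def split: if_splits)

lemma part_eq_imp_val_le: "part v x = x \<Longrightarrow> val_le v x"
  by (cases x) (auto split: if_splits)

lemma val_le_add: "val_le v x \<Longrightarrow> val_le v y \<Longrightarrow> val_le v (x + y)"
  by (cases x; cases y) auto

lemma part_add: "val_le v x \<Longrightarrow> val_le v y \<Longrightarrow> part v (x + y) = part v x + part v y"
  by (cases x; cases y) auto

lemma val_le_mult: "val_le v x \<Longrightarrow> val_le w y \<Longrightarrow> val_le (v + w) (x * y)"
  by (cases x; cases y) (auto intro: add_mono)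

lemma part_mult: "val_le v x \<Longrightarrow> val_le w y \<Longrightarrow> part (v + w) (x * y) = part v x * part w y"
  by (cases x; cases y)
    (auto dest: add_less_le_mono add_le_less_mono simp: order_le_less)

lemma add_eq_0_layered: "x + y = 0 \<longleftrightarrow> x = 0 \<and> y = 0"
  by (cases x; cases y) (auto simp: zero_layered_def)

end

lemma
  fixes h :: "'a \<Rightarrow> ('g::linordered_ab_group_add, 'l::{comm_semiring, monoid_mult}) layered"
  assumes "\<And>i. i \<in> S \<Longrightarrow> val_le v (h i)"
  shows val_le_sum: "val_le v (sum h S)"
    and part_sum: "part v (sum h S) = (\<Sum>i\<in>S. part v (h i))"
  using assms by (induction S rule: infinite_finite_induct) (auto simp: val_le_add part_add)

lemma
  fixes h :: "'a \<Rightarrow> ('g::linordered_ab_group_add, 'l::{comm_semiring, monoid_mult}) layered"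
  assumes "\<And>i. i \<in> S \<Longrightarrow> val_le (v i) (h i)"
  shows val_le_prod: "val_le (sum v S) (prod h S)"
    and part_prod: "part (sum v S) (prod h S) = (\<Prod>i\<in>S. part (v i) (h i))"
  using assms
  by (induction S rule: infinite_finite_induct)
    (auto simp: val_le_mult part_mult val_le_zero_1 part_zero_1)

lemma sum_eq_0_layered:
  fixes h :: "'a \<Rightarrow> ('g::linordered_ab_group_add, 'l::{comm_semiring, monoid_mult}) layered"
  assumes "finite S"
  shows "sum h S = 0 \<longleftrightarrow> (\<forall>i\<in>S. h i = 0)"
  using assms by (induction S) (auto simp: add_eq_0_layered)

lemma
  fixes h :: "'a \<Rightarrow> ('g::linordered_ab_group_add, 'l::{comm_semiring, monoid_mult}) layered"
  assumes "finite S" "j \<in> S" "val_le v (h j)"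
    and less: "\<And>i. i \<in> S \<Longrightarrow> i \<noteq> j \<Longrightarrow> val_less v (h i)"
  shows val_le_sum_dominant: "val_le v (sum h S)"
    and part_sum_dominant: "part v (sum h S) = part v (h j)"
proof -
  have le: "val_le v (h i)" if "i \<in> S" for i
    using assms that val_less_imp_le[of v "h i"] by (cases "i = j") auto
  then show "val_le v (sum h S)" by (rule val_le_sum)
  have "part v (sum h S) = (\<Sum>i\<in>S. part v (h i))"
    using le by (rule part_sum)
  also have "\<dots> = (\<Sum>i\<in>{j}. part v (h i))"
    using assms by (intro sum.mono_neutral_right) (auto simp: part_eq_0)
  finally show "part v (sum h S) = part v (h j)" by simp
qed

text \<open>A permutation meets every row and every column once, so all products share one bound,
  the sum of all potentials; \<open>part\<close> at this bound passes through the sum and then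
  through each product.\<close>

lemma part_lperm:
  fixes A :: "nat \<Rightarrow> nat \<Rightarrow> ('g::linordered_ab_group_add, 'l::{comm_semiring, monoid_mult}) layered"
  assumes "\<And>r c. r < N \<Longrightarrow> c < N \<Longrightarrow> val_le (u r + v c) (A r c)"
  shows "part ((\<Sum>r<N. u r) + (\<Sum>c<N. v c)) (lperm N A) = lperm N (\<lambda>r c. part (u r + v c) (A r c))"
proof -
  have V: "(\<Sum>r<N. u r) + (\<Sum>c<N. v c) = (\<Sum>r<N. u r + v (\<sigma> r))" if "\<sigma> permutes {..<N}" for \<sigma>
    using sum.permute[OF that, of v] by (simp add: sum.distrib o_def)
  have le: "val_le (u r + v (\<sigma> r)) (A r (\<sigma> r))" if "\<sigma> permutes {..<N}" "r < N" for \<sigma> r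
    using assms permutes_in_image[OF that(1)] that(2) by auto
  have "part ((\<Sum>r<N. u r) + (\<Sum>c<N. v c)) (lperm N A) =
      (\<Sum>\<sigma> | \<sigma> permutes {..<N}. part ((\<Sum>r<N. u r) + (\<Sum>c<N. v c)) (\<Prod>r<N. A r (\<sigma> r)))"
    unfolding lperm_def
  proof (rule part_sum)
    fix \<sigma> assume "\<sigma> \<in> {\<sigma>. \<sigma> permutes {..<N}}"
    then have \<sigma>: "\<sigma> permutes {..<N}" by simp
    show "val_le ((\<Sum>r<N. u r) + (\<Sum>c<N. v c)) (\<Prod>r<N. A r (\<sigma> r))"
      unfolding V[OF \<sigma>] by (rule val_le_prod) (simp add: le[OF \<sigma>])
  qed
  also have "\<dots> = lperm N (\<lambda>r c. part (u r + v c) (A r c))"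
    unfolding lperm_def
  proof (rule sum.cong)
    fix \<sigma> assume "\<sigma> \<in> {\<sigma>. \<sigma> permutes {..<N}}"
    then have \<sigma>: "\<sigma> permutes {..<N}" by simp
    show "part ((\<Sum>r<N. u r) + (\<Sum>c<N. v c)) (\<Prod>r<N. A r (\<sigma> r)) =
        (\<Prod>r<N. part (u r + v (\<sigma> r)) (A r (\<sigma> r)))"
      unfolding V[OF \<sigma>] by (rule part_prod) (simp add: le[OF \<sigma>])
  qed simp
  finally show ?thesis .
qed

lemma prod_nonzero:
  fixes h :: "'a \<Rightarrow> 'b::{comm_semiring_1, semiring_no_zero_divisors}"
  assumes "\<And>i. i \<in> S \<Longrightarrow> h i \<noteq> 0"
  shows "prod h S \<noteq> 0"
  using assms by (induction S rule: infinite_finite_induct) auto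

text \<open>The diagonal entries are \<open>coeff f 0\<close> and \<open>lead_coeff g\<close>, and a
  sum of layered elements vanishes only if every term does.\<close>

lemma lresultant_nonzero:
  fixes f g :: "('g::linordered_ab_group_add, 'l::{comm_semiring, monoid_mult}) layered poly"
  assumes "coeff f 0 \<noteq> 0" "g \<noteq> 0"
  shows "lresultant f g \<noteq> 0"
proof -
  let ?N = "degree f + degree g"
  have "(\<Prod>i<?N. sylvester f g i (id i)) \<noteq> 0"
    using assms by (intro prod_nonzero) (auto simp: sylvester_def)
  moreover have "finite {\<sigma>. \<sigma> permutes {..<?N}}" by (simp add: finite_permutations)
  ultimately show ?thesis
    unfolding lresultant_def lperm_def using permutes_id[of "{..<?N}"]
    by (subst sum_eq_0_layered) blast+
qed

subsection \<open>Newton polygons and the splitting of the smallest root\<close>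

text \<open>The power \<open>a^n\<close> of the multiplicatively written value group.\<close>

primrec nmul :: "nat \<Rightarrow> 'a::comm_monoid_add \<Rightarrow> 'a" where
  "nmul 0 a = 0"
| "nmul (Suc n) a = a + nmul n a"

lemma nmul_add: "nmul (m + n) a = nmul m a + nmul n a"
  by (induction m) (auto simp: ac_simps)

text \<open>Values of coefficients equal those of \<open>(\<lambda> + a)^t\<close>; unlike for primary polynomials, the
  constant term must not vanish.\<close>

definition homogeneous :: "'g \<Rightarrow> ('g::linordered_ab_group_add, 'l::{comm_semiring, monoid_mult}) layered poly \<Rightarrow> bool" where
  "homogeneous a f \<longleftrightarrow> coeff f 0 \<noteq> 0 \<and>
     (\<forall>i\<le>degree f. part (nmul (degree f - i) a) (coeff f i) = coeff f i)"

text \<open>\<open>F\<close> is the Newton polygon of \<open>f\<close>, whose successive drops are the roots of \<open>f\<close>.\<close>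

definition polygon :: "'g set \<Rightarrow> ('g::linordered_ab_group_add, 'l::{comm_semiring, monoid_mult}) layered poly
    \<Rightarrow> (nat \<Rightarrow> 'g) \<Rightarrow> bool" where
  "polygon A f F \<longleftrightarrow> F (degree f) = 0 \<and> (\<forall>i<degree f. \<exists>b\<in>A. F i = b + F (Suc i)) \<and>
     (\<forall>i\<le>degree f. val_le (F i) (coeff f i)) \<and> part (F 0) (coeff f 0) \<noteq> 0"

text \<open>The Newton polygon after multiplication by a polynomial of degree \<open>m\<close> all of whose roots
  have value \<open>a\<close>, below every drop of \<open>F\<close>.\<close>

definition extend :: "nat \<Rightarrow> 'g::linordered_ab_group_add \<Rightarrow> (nat \<Rightarrow> 'g) \<Rightarrow> nat \<Rightarrow> 'g" where
  "extend m a F i = (if i \<le> m then nmul (m - i) a + F 0 else F (i - m))"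

lemma extend_add [simp]: "extend m a F (m + s) = F s"
  by (auto simp: extend_def)

lemma extend_le: "i \<le> m \<Longrightarrow> extend m a F i = nmul (m - i) a + F 0"
  by (simp add: extend_def)

text \<open>\<open>F s\<close> exceeds \<open>F (s + t)\<close> by a sum of \<open>t\<close>
  elements of \<open>A\<close>, each larger than \<open>a\<close>.\<close>

lemma polygon_drop_strict:
  assumes pol: "polygon A f F" and a: "\<And>b. b \<in> A \<Longrightarrow> a < b" and s: "s + t \<le> degree f"
    and t: "0 < t"
  shows "nmul t a + F (s + t) < F s"
proof -
  \<comment> \<open>The weak inequality is carried along because the induction starts at
    \<open>t = 0\<close>, where the strict one fails.\<close>
  have "nmul t a + F (s + t) \<le> F s \<and> (0 < t \<longrightarrow> nmul t a + F (s + t) < F s)"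
    using s
  proof (induction t)
    case (Suc t)
    then have IH: "nmul t a + F (s + t) \<le> F s" by auto
    from Suc.prems have "s + t < degree f" by simp
    with pol obtain b where b: "b \<in> A" "F (s + t) = b + F (Suc (s + t))"
      unfolding polygon_def by blast
    have "nmul (Suc t) a + F (s + Suc t) = a + (nmul t a + F (Suc (s + t)))"
      by (simp add: ac_simps)
    also have "\<dots> < b + (nmul t a + F (Suc (s + t)))"
      using a[OF b(1)] by simp
    also have "\<dots> = nmul t a + F (s + t)"
      using b(2) by (simp add: ac_simps)
    also have "\<dots> \<le> F s" using IH by auto
    finally show ?case by (simp only: less_imp_le simp_thms)
  qed simp
  then show ?thesis using t by simp
qed

text \<open>Passing from the term \<open>j = i\<close> to a smaller \<open>j\<close>, the bound for
  \<open>coeff p j\<close> gains \<open>i - j\<close> times \<open>a\<close>, but that for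
  \<open>coeff f (i - j)\<close> loses \<open>i - j\<close> roots larger than \<open>a\<close>. Only
  the term \<open>j = i\<close> can attain the bound.\<close>

lemma
  assumes hom: "homogeneous a p" and pol: "polygon A f F" and a: "\<And>b. b \<in> A \<Longrightarrow> a < b"
    and i: "i \<le> degree p"
  shows val_le_coeff_mult_low: "val_le (extend (degree p) a F i) (coeff (p * f) i)"
    and part_coeff_mult_low: "part (extend (degree p) a F i) (coeff (p * f) i) = coeff p i * coeff f 0"
proof -
  let ?m = "degree p" and ?w = "extend (degree p) a F i"
  have p: "val_le (nmul (?m - j) a) (coeff p j)" if "j \<le> ?m" for j
    using hom that by (auto simp: homogeneous_def intro: part_eq_imp_val_le)
  have f: "val_le (F j) (coeff f j)" if "j \<le> degree f" for j
    using pol that by (auto simp: polygon_def)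
  have w: "?w = nmul (?m - i) a + F 0" using i by (rule extend_le)
  have le: "val_le ?w (coeff p i * coeff f (i - i))"
    using p[OF i] f[of 0] by (auto simp: w intro: val_le_mult)
  have less: "val_less ?w (coeff p j * coeff f (i - j))" if "j \<le> i" "j \<noteq> i" for j
  proof (cases "i - j \<le> degree f")
    case True
    have "nmul (?m - j) a + F (i - j) = nmul (?m - i) a + (nmul (i - j) a + F (i - j))"
      using that i nmul_add[of "?m - i" "i - j" a] by (simp add: ac_simps)
    also have "\<dots> < ?w"
      using polygon_drop_strict[OF pol a, of 0 "i - j"] that True by (simp add: w)
    finally show ?thesis
      using val_le_mult[OF p f, of j "i - j"] that i True by (auto intro: val_le_less_trans)
  qed (simp add: coeff_eq_0)
  have "val_le ?w (coeff (p * f) i) \<and> part ?w (coeff (p * f) i) = part ?w (coeff p i * coeff f (i - i))"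
    unfolding coeff_mult
    using val_le_sum_dominant[of "{..i}" i ?w "\<lambda>j. coeff p j * coeff f (i - j)"]
      part_sum_dominant[of "{..i}" i ?w "\<lambda>j. coeff p j * coeff f (i - j)"] le less by auto
  moreover have "part (F 0) (coeff f 0) = coeff f 0"
    using pol by (auto simp: polygon_def intro: part_idem)
  then have "part ?w (coeff p i * coeff f (i - i)) = coeff p i * coeff f 0"
    using part_mult[OF p[OF i] f[of 0]] hom i by (simp add: w homogeneous_def)
  ultimately show "val_le ?w (coeff (p * f) i)" "part ?w (coeff (p * f) i) = coeff p i * coeff f 0"
    by auto
qed

text \<open>The same exchange at indices from \<open>degree p\<close> on: now only the leading
  coefficient of \<open>p\<close> counts. The bound \<open>w\<close> may exceed \<open>F s\<close>,
  since it will be a sum of a row and a column potential.\<close>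

lemma
  assumes hom: "homogeneous a p" and pol: "polygon A f F" and a: "\<And>b. b \<in> A \<Longrightarrow> a < b"
    and w: "s \<le> degree f \<Longrightarrow> F s \<le> w"
  shows val_le_coeff_mult_high: "val_le w (coeff (p * f) (degree p + s))"
    and part_coeff_mult_high:
      "part w (coeff (p * f) (degree p + s)) = lead_coeff p * part w (coeff f s)"
proof -
  let ?m = "degree p" and ?i = "degree p + s"
  have p: "val_le (nmul (?m - j) a) (coeff p j)" if "j \<le> ?m" for j
    using hom that by (auto simp: homogeneous_def intro: part_eq_imp_val_le)
  have p0: "val_le 0 (lead_coeff p)" using p[of ?m] by simp
  have f: "val_le (F j) (coeff f j)" if "j \<le> degree f" for j
    using pol that by (auto simp: polygon_def)
  have fs: "val_le w (coeff f s)"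
    using f[of s] w by (cases "s \<le> degree f") (auto simp: coeff_eq_0 intro: val_le_trans)
  have le: "val_le w (coeff p ?m * coeff f (?i - ?m))"
    using val_le_mult[OF p0 fs] by simp
  have less: "val_less w (coeff p j * coeff f (?i - j))" if "j \<le> ?i" "j \<noteq> ?m" for j
  proof (cases "j < ?m \<and> ?i - j \<le> degree f")
    case True
    then have ij: "?i - j = s + (?m - j)" by simp
    have "nmul (?m - j) a + F (?i - j) < F s"
      using polygon_drop_strict[OF pol a, of s "?m - j"] True unfolding ij by linarith
    also have "F s \<le> w" using True by (intro w) linarith
    finally show ?thesis
      using val_le_mult[OF p f, of j "?i - j"] True by (auto intro: val_le_less_trans)
  next
    case False
    then show ?thesis using that by (auto simp: coeff_eq_0)
  qed
  have "val_le w (coeff (p * f) ?i) \<and> part w (coeff (p * f) ?i) = part w (coeff p ?m * coeff f (?i - ?m))"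
    unfolding coeff_mult
    using val_le_sum_dominant[of "{..?i}" ?m w "\<lambda>j. coeff p j * coeff f (?i - j)"]
      part_sum_dominant[of "{..?i}" ?m w "\<lambda>j. coeff p j * coeff f (?i - j)"] le less by auto
  moreover have "part 0 (lead_coeff p) = lead_coeff p"
    using hom unfolding homogeneous_def by (metis diff_self_eq_0 le_refl nmul.simps(1))
  ultimately show "val_le w (coeff (p * f) ?i)"
      "part w (coeff (p * f) ?i) = lead_coeff p * part w (coeff f s)"
    using part_mult[OF p0 fs] by auto
qed

lemma homogeneous_nonzero: "homogeneous a f \<Longrightarrow> f \<noteq> 0"
  by (auto simp: homogeneous_def)

lemma polygon_nonzero: "polygon A f F \<Longrightarrow> f \<noteq> 0"
  by (auto simp: polygon_def)

lemma polygon_mult: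
  assumes hom: "homogeneous a p" and pol: "polygon A f F" and a: "\<And>b. b \<in> A \<Longrightarrow> a < b"
  shows "polygon (insert a A) (p * f) (extend (degree p) a F)"
proof -
  let ?m = "degree p" and ?F = "extend (degree p) a F"
  have deg: "degree (p * f) = ?m + degree f"
    using hom pol by (simp add: degree_mult_eq homogeneous_nonzero polygon_nonzero)
  have "?F (degree (p * f)) = 0"
    using pol by (simp add: deg polygon_def)
  moreover have "\<exists>b\<in>insert a A. ?F i = b + ?F (Suc i)" if "i < degree (p * f)" for i
  proof (cases "i < ?m")
    case True
    then have "?m - i = Suc (?m - Suc i)" by simp
    then show ?thesis using True by (simp add: extend_le ac_simps)
  next
    case False
    then obtain s where "i = ?m + s" using le_Suc_ex not_less by blast
    then show ?thesis
      using that pol extend_add[of ?m a F "Suc s"] by (auto simp: deg polygon_def)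
  qed
  moreover have "val_le (?F i) (coeff (p * f) i)" if "i \<le> degree (p * f)" for i
  proof (cases "i \<le> ?m")
    case False
    then obtain s where "i = ?m + s" using le_Suc_ex nat_le_linear by blast
    then show ?thesis
      using val_le_coeff_mult_high[OF hom pol a, of s "F s"] by simp
  qed (rule val_le_coeff_mult_low[OF hom pol a])
  moreover have "part (?F 0) (coeff (p * f) 0) \<noteq> 0"
    using part_coeff_mult_low[OF hom pol a, of 0] hom pol
    by (auto simp: homogeneous_def polygon_def)
  ultimately show ?thesis by (simp add: polygon_def)
qed

text \<open>Row potentials of the Sylvester matrix; together with the column potential \<open>H\<close> they bound the
  entry \<open>(r, r + i)\<close> because \<open>F i + G r \<le> H (i + r)\<close>.\<close>

definition potential :: "nat \<Rightarrow> (nat \<Rightarrow> 'g::linordered_ab_group_add) \<Rightarrow> (nat \<Rightarrow> 'g) \<Rightarrow> nat \<Rightarrow> 'g" where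
  "potential n F G r = (if r < n then - G r else - F (r - n))"

text \<open>Under the hypotheses of \<open>part_weight_lresultant\<close> this bounds the value of
  every product in the permanent.\<close>

definition weight :: "nat \<Rightarrow> nat \<Rightarrow> (nat \<Rightarrow> 'g::linordered_ab_group_add) \<Rightarrow> (nat \<Rightarrow> 'g) \<Rightarrow> (nat \<Rightarrow> 'g) \<Rightarrow> 'g" where
  "weight m n F G H = (\<Sum>r<m + n. potential n F G r) + (\<Sum>c<m + n. H c)"

text \<open>A Sylvester row taken by itself, so that the rows of both polynomials fall under the
  same lemmas.\<close>

definition shifted :: "'a::comm_semiring_1 poly \<Rightarrow> nat \<Rightarrow> nat \<Rightarrow> 'a" where
  "shifted f r c = (if r \<le> c then coeff f (c - r) else 0)"

lemma sylvester_shifted: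
  "sylvester f g r c = (if r < degree g then shifted f r c else shifted g (r - degree g) c)"
  by (simp add: sylvester_def shifted_def)

lemma val_le_shifted:
  assumes pol: "polygon A f F"
    and conv: "\<And>i. i \<le> degree f \<Longrightarrow> F i + G r \<le> H (i + r)"
  shows "val_le (- G r + H c) (shifted f r c)"
proof (cases "r \<le> c \<and> c - r \<le> degree f")
  case True
  have "F (c - r) \<le> - G r + H c"
    using conv[of "c - r"] True by (simp add: algebra_simps le_diff_eq)
  moreover have "val_le (F (c - r)) (coeff f (c - r))"
    using pol True by (auto simp: polygon_def)
  ultimately show ?thesis using True by (auto simp: shifted_def intro: val_le_trans)
qed (auto simp: shifted_def coeff_eq_0)

lemma part_weight_lresultant:
  assumes polf: "polygon A f F" and polg: "polygon B g G"
    and conv: "\<And>i r. i \<le> degree f \<Longrightarrow> r \<le> degree g \<Longrightarrow> F i + G r \<le> H (i + r)"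
  shows "part (weight (degree f) (degree g) F G H) (lresultant f g) =
    lperm (degree f + degree g) (\<lambda>r c. part (potential (degree g) F G r + H c) (sylvester f g r c))"
  unfolding weight_def lresultant_def
proof (rule part_lperm)
  fix r c assume r: "r < degree f + degree g"
  show "val_le (potential (degree g) F G r + H c) (sylvester f g r c)"
  proof (cases "r < degree g")
    case True
    then show ?thesis
      using val_le_shifted[OF polf, of G r H c] conv by (simp add: potential_def sylvester_shifted)
  next
    case False
    have "val_le (- F (r - degree g) + H c) (shifted g (r - degree g) c)"
      using val_le_shifted[OF polg, of F "r - degree g" H c] conv[of "r - degree g"] r False
      by (simp add: add.commute)
    then show ?thesis using False by (simp add: potential_def sylvester_shifted)
  qed
qed

section \<open>Block triangular form when the smallest root is split off\<close>

lemma prod_if_less: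
  "(\<Prod>r<m + n. if r < m then x else y) = x ^ m * (y :: 'a::comm_monoid_mult) ^ n"
  by (induction n) (auto simp: ac_simps)

text \<open>One step: \<open>p\<close> and \<open>q\<close> carry the root \<open>a\<close>,
  \<open>f\<close> and \<open>g\<close> only larger ones. The last two assumptions are what
  \<open>H\<close> must share with the Newton polygon of \<open>f * g\<close>; both pass on to
  \<open>H'\<close>.\<close>

locale peel =
  fixes a :: "'g::linordered_ab_group_add" and A :: "'g set"
    and p q f g :: "('g, 'l::{comm_semiring, monoid_mult}) layered poly"
    and F G H :: "nat \<Rightarrow> 'g"
  assumes a_less: "\<And>b. b \<in> A \<Longrightarrow> a < b"
    and hom_p: "homogeneous a p" and hom_q: "homogeneous a q"
    and pol_f: "polygon A f F" and pol_g: "polygon A g G"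
    and conv: "\<And>i r. i \<le> degree f \<Longrightarrow> r \<le> degree g \<Longrightarrow> F i + G r \<le> H (i + r)"
    and H_0: "H 0 = F 0 + G 0"
begin

abbreviation "F' \<equiv> extend (degree p) a F"
abbreviation "G' \<equiv> extend (degree q) a G"
abbreviation "H' \<equiv> extend (degree p + degree q) a H"

text \<open>Lets every result about the rows of \<open>p * f\<close> be reused for the rows of
  \<open>q * g\<close>.\<close>

lemma swap: "peel a A q p g f G F H"
proof
  show "G i + F r \<le> H (i + r)" if "i \<le> degree g" "r \<le> degree f" for i r
    using conv[OF that(2,1)] by (simp add: add.commute)
qed (use a_less hom_p hom_q pol_f pol_g H_0 in \<open>auto simp: add.commute\<close>)

lemma degree_pf: "degree (p * f) = degree p + degree f"
  using hom_p pol_f by (simp add: degree_mult_eq homogeneous_nonzero polygon_nonzero)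

text \<open>At these indices \<open>G'\<close> has already given up roots larger than
  \<open>a\<close>, while \<open>F'\<close> still holds copies of \<open>a\<close>.
  \<open>H'\<close> gives up all copies of \<open>a\<close> first, which leaves a strictly larger
  value. This strictness produces the zeros of the matrix of parts.\<close>

lemma extend_conv_less:
  assumes i: "i < degree p" and r: "degree q < r" "r \<le> degree q + degree g"
  shows "F' i + G' r < H' (i + r)"
proof -
  define t where "t = degree p - i"
  obtain s where s: "r = degree q + s" using r le_Suc_ex less_imp_le by blast
  have t: "0 < t" "i + t = degree p" using i by (auto simp: t_def)
  have s0: "0 < s" "s \<le> degree g" using r s by auto
  have lhs: "F' i + G' r = nmul t a + F 0 + G s"
    using i by (simp add: extend_le s t_def)
  show ?thesis
  \<comment> \<open>The \<open>t\<close> copies of \<open>a\<close> left in \<open>F'\<close> are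
    traded against the \<open>s\<close> roots given up by \<open>G'\<close>; \<open>min t s\<close>
    trades are possible.\<close>
  proof (cases "t \<le> s")
    case True
    then have "i + r = degree p + degree q + (s - t)" using t s by simp
    then have rhs: "H' (i + r) = H (s - t)" by (simp only: extend_add)
    have "nmul t a + G s < G (s - t)"
      using polygon_drop_strict[OF pol_g a_less, of "s - t" t] t s0 True by simp
    then have "nmul t a + F 0 + G s < F 0 + G (s - t)" by (simp add: ac_simps)
    also have "\<dots> \<le> H (s - t)" using conv[of 0 "s - t"] s0 by simp
    finally show ?thesis by (simp only: lhs rhs)
  next
    case False
    then have ir: "i + r \<le> degree p + degree q" "degree p + degree q - (i + r) = t - s"
      using t s by auto
    have "nmul s a + G s < G 0"
      using polygon_drop_strict[OF pol_g a_less, of 0 s] s0 by simp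
    moreover have "nmul t a = nmul (t - s) a + nmul s a"
      using nmul_add[of "t - s" s a] False by simp
    ultimately show ?thesis
      using ir by (simp add: lhs extend_le H_0 ac_simps)
  qed
qed

text \<open>Up to these indices all three polygons drop by \<open>a\<close> only.\<close>

lemma extend_conv_eq:
  "i \<le> degree p \<Longrightarrow> r \<le> degree q \<Longrightarrow> F' i + G' r = H' (i + r)"
  using nmul_add[of "degree p - i" "degree q - r" a]
  by (simp add: extend_le H_0 ac_simps)

lemma extend_conv_half:
  assumes i: "i \<le> degree p" and r: "r \<le> degree q + degree g"
  shows "F' i + G' r \<le> H' (i + r)"
proof -
  consider "r \<le> degree q" | "i < degree p" "degree q < r" | "i = degree p" "degree q < r"
    using i by linarith
  then show ?thesis
  proof cases
    case 3
    then obtain s where s: "r = degree q + s" using le_Suc_ex less_imp_le by blast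
    then have "H' (i + r) = H s" using 3 extend_add[of "degree p + degree q" a H s]
      by (simp add: add.assoc)
    then show ?thesis using conv[of 0 s] 3 s r by (simp add: extend_le)
  qed (use extend_conv_eq i extend_conv_less r in \<open>auto simp: order_le_less\<close>)
qed

lemma extend_conv:
  assumes i: "i \<le> degree p + degree f" and r: "r \<le> degree q + degree g"
  shows "F' i + G' r \<le> H' (i + r)"
proof -
  interpret s: peel a A q p g f G F H by (rule swap)
  \<comment> \<open>Within the first range of either polygon \<open>extend_conv_half\<close>
    applies, with roles exchanged if necessary; beyond both, the inequality is \<open>conv\<close>
    with shifted indices.\<close>
  consider "i \<le> degree p" | "r \<le> degree q" | "degree p \<le> i" "degree q \<le> r" by linarith
  then show ?thesis
  proof cases
    case 1
    then show ?thesis using extend_conv_half r by simp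
  next
    case 2
    then show ?thesis using s.extend_conv_half[of r i] i by (simp add: add.commute)
  next
    case 3
    then obtain i' r' where "i = degree p + i'" "r = degree q + r'" using le_Suc_ex by blast
    moreover from this have "i + r = degree p + degree q + (i' + r')" by simp
    ultimately show ?thesis
      using conv[of i' r'] i r by (simp only: extend_add)
  qed
qed

lemma part_shifted_eq_0:
  assumes "degree p + degree f < c - r \<or> c < r \<or> F' (c - r) + G' r < H' c"
  shows "part (- G' r + H' c) (shifted (p * f) r c) = 0"
proof (cases "r \<le> c \<and> c - r \<le> degree p + degree f")
  case True
  then have "F' (c - r) < - G' r + H' c"
    using assms by (auto simp: algebra_simps less_diff_eq)
  moreover have "val_le (F' (c - r)) (coeff (p * f) (c - r))"
    using polygon_mult[OF hom_p pol_f a_less] True by (auto simp: polygon_def degree_pf)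
  ultimately show ?thesis
    using True by (auto simp: shifted_def intro: part_eq_0 val_le_less_trans)
next
  case False
  then show ?thesis by (auto simp: shifted_def coeff_eq_0 degree_pf)
qed

text \<open>The strict case with exchanged roles: \<open>r\<close> is below \<open>degree q\<close>,
  while \<open>c - r\<close> exceeds \<open>degree p\<close>.\<close>

lemma part_shifted_right:
  assumes r: "r < degree q" and c: "degree p + r < c"
  shows "part (- G' r + H' c) (shifted (p * f) r c) = 0"
proof (rule part_shifted_eq_0)
  interpret s: peel a A q p g f G F H by (rule swap)
  show "degree p + degree f < c - r \<or> c < r \<or> F' (c - r) + G' r < H' c"
    using s.extend_conv_less[of r "c - r"] r c by (simp add: add.commute) linarith
qed

text \<open>For \<open>r \<le> c\<close> and \<open>c - r \<le> degree p\<close> the potentials add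
  up exactly to \<open>F' (c - r)\<close>, so the entry keeps its dominant term; elsewhere both
  sides vanish.\<close>

lemma part_shifted_block1:
  assumes r: "r < degree q" and c: "c < degree p + degree q"
  shows "part (- G' r + H' c) (shifted (p * f) r c) = coeff f 0 * shifted p r c"
proof -
  consider "c < r" | "r \<le> c" "c - r \<le> degree p" | "degree p + r < c" by linarith
  then show ?thesis
  proof cases
    case 1
    then show ?thesis by (simp add: shifted_def)
  next
    case 2
    then have "- G' r + H' c = F' (c - r)"
      using extend_conv_eq[of "c - r" r] r by (simp add: algebra_simps)
    then show ?thesis
      using 2 part_coeff_mult_low[OF hom_p pol_f a_less, of "c - r"]
      by (simp add: shifted_def mult.commute)
  next
    case 3
    then show ?thesis
      using part_shifted_right[OF r] by (simp add: shifted_def coeff_eq_0)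
  qed
qed

lemma part_shifted_block2:
  assumes s: "s \<le> degree g"
  shows "part (- G' (degree q + s) + H' (degree p + degree q + d))
      (shifted (p * f) (degree q + s) (degree p + degree q + d)) =
    lead_coeff p * part (- G s + H d) (shifted f s d)"
proof (cases "s \<le> d")
  case True
  have "F (d - s) \<le> - G s + H d" if "d - s \<le> degree f"
    using conv[OF that s] True by (simp add: algebra_simps le_diff_eq)
  moreover have "degree p + degree q + d - (degree q + s) = degree p + (d - s)"
    using True by simp
  ultimately show ?thesis
    using True part_coeff_mult_high[OF hom_p pol_f a_less, of "d - s" "- G s + H d"]
    by (simp add: shifted_def)
next
  case False
  \<comment> \<open>Since \<open>d < s\<close>, the distance from the diagonal is below
    \<open>degree p\<close> and the row lies beyond \<open>degree q\<close>: the strict case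
    again.\<close>
  have "part (- G' (degree q + s) + H' (degree p + degree q + d))
      (shifted (p * f) (degree q + s) (degree p + degree q + d)) = 0"
  proof (rule part_shifted_eq_0)
    let ?c = "degree p + degree q + d" and ?r = "degree q + s"
    have "F' (?c - ?r) + G' ?r < H' (?c - ?r + ?r)" if "?r \<le> ?c"
      using extend_conv_less[of "?c - ?r" ?r] False s that by linarith
    then show "degree p + degree f < ?c - ?r \<or> ?c < ?r \<or> F' (?c - ?r) + G' ?r < H' ?c"
      by (metis le_add_diff_inverse2 not_less)
  qed
  then show ?thesis using False by (simp add: shifted_def)
qed

text \<open>Some rows reduce to rows of \<open>p\<close> and \<open>q\<close> times a constant term
  of \<open>f\<close> or \<open>g\<close>, the others to the parts of rows of \<open>f\<close> and
  \<open>g\<close> times a leading coefficient of \<open>p\<close> or \<open>q\<close>; the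
  exponents count these rows.\<close>

lemma part_weight_mult:
  "part (weight (degree p + degree f) (degree q + degree g) F' G' H') (lresultant (p * f) (q * g)) =
    coeff f 0 ^ degree q * coeff g 0 ^ degree p * lresultant p q *
    (lead_coeff p ^ degree g * lead_coeff q ^ degree f *
      part (weight (degree f) (degree g) F G H) (lresultant f g))"
proof -
  interpret s: peel a A q p g f G F H by (rule swap)
  let ?m = "degree p" and ?n = "degree q" and ?k = "degree p + degree q"
  let ?l = "degree f + degree g"
  let ?T = "\<lambda>r c. part (potential (?n + degree g) F' G' r + H' c) (sylvester (p * f) (q * g) r c)"
  \<comment> \<open>Brings the first \<open>degree q\<close> rows of \<open>p * f\<close> and the
    first \<open>degree p\<close> rows of \<open>q * g\<close> to the top.\<close>
  let ?\<pi> = "swap_segments ?n ?m (degree g)"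
  have N: "?m + degree f + (?n + degree g) = ?k + ?l" by simp
  have H': "extend (?n + ?m) a H = H'" by (simp add: add.commute)
  have T: "?T r c = (if r < ?n + degree g then part (- G' r + H' c) (shifted (p * f) r c)
      else part (- F' (r - (?n + degree g)) + H' c) (shifted (q * g) (r - (?n + degree g)) c))" for r c
    by (simp add: potential_def sylvester_shifted s.degree_pf)
  have "part (weight (?m + degree f) (?n + degree g) F' G' H') (lresultant (p * f) (q * g)) =
      lperm (?k + ?l) ?T"
    using part_weight_lresultant[OF polygon_mult[OF hom_p pol_f a_less]
        polygon_mult[OF hom_q pol_g a_less], of H'] extend_conv
    unfolding degree_pf s.degree_pf N by blast
  also have "\<dots> = lperm (?k + ?l) (\<lambda>r. ?T (?\<pi> r))"
    by (intro lperm_permute_rows[symmetric] swap_segments_permutes) simp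
  \<comment> \<open>In the top row coming from row \<open>r\<close> of \<open>p * f\<close> the
    bound is attained at most up to column \<open>degree p + r\<close>, which is less than
    \<open>?k\<close>; likewise for \<open>q * g\<close>.\<close>
  also have "\<dots> = lperm ?k (\<lambda>r. ?T (?\<pi> r)) * lperm ?l (\<lambda>r c. ?T (?\<pi> (?k + r)) (?k + c))"
  proof (rule lperm_lower_block)
    fix r c assume "r < ?k" "?k \<le> c"
    then show "?T (?\<pi> r) c = 0"
      using part_shifted_right[of r c] s.part_shifted_right[of "r - ?n" c]
      unfolding T by (auto simp: swap_segments_def H')
  qed
  also have "lperm ?k (\<lambda>r. ?T (?\<pi> r)) =
      lperm ?k (\<lambda>r c. (if r < ?n then coeff f 0 else coeff g 0) * sylvester p q r c)"
  proof (rule lperm_cong)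
    fix r c assume "r < ?k" "c < ?k"
    then show "?T (?\<pi> r) c = (if r < ?n then coeff f 0 else coeff g 0) * sylvester p q r c"
      using part_shifted_block1[of r c] s.part_shifted_block1[of "r - ?n" c]
      unfolding T by (auto simp: swap_segments_def H' sylvester_shifted)
  qed
  also have "\<dots> = coeff f 0 ^ ?n * coeff g 0 ^ ?m * lresultant p q"
    by (simp add: lresultant_def lperm_scale_rows add.commute[of ?m] prod_if_less)
  also have "lperm ?l (\<lambda>r c. ?T (?\<pi> (?k + r)) (?k + c)) =
      lperm ?l (\<lambda>r c. (if r < degree g then lead_coeff p else lead_coeff q) *
        part (potential (degree g) F G r + H c) (sylvester f g r c))"
  proof (rule lperm_cong)
    fix r c assume "r < ?l"
    then show "?T (?\<pi> (?k + r)) (?k + c) = (if r < degree g then lead_coeff p else lead_coeff q) *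
        part (potential (degree g) F G r + H c) (sylvester f g r c)"
    proof (cases "r < degree g")
      case True
      then have "?\<pi> (?k + r) = ?n + r" by (simp add: swap_segments_def)
      then show ?thesis
        using part_shifted_block2[of r c] True
        unfolding T by (simp add: sylvester_shifted potential_def)
    next
      case False
      then have \<pi>: "?\<pi> (?k + r) - (?n + degree g) = ?m + (r - degree g)"
        and "\<not> ?\<pi> (?k + r) < ?n + degree g" by (auto simp: swap_segments_def)
      then have "?T (?\<pi> (?k + r)) (?k + c) =
          part (- F' (?m + (r - degree g)) + H' (?k + c)) (shifted (q * g) (?m + (r - degree g)) (?k + c))"
        unfolding T by simp
      also have "r - degree g \<le> degree f" using \<open>r < ?l\<close> by simp
      from s.part_shifted_block2[OF this, of c]
      have "part (- F' (?m + (r - degree g)) + H' (?k + c)) (shifted (q * g) (?m + (r - degree g)) (?k + c)) =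
          lead_coeff q * part (- F (r - degree g) + H c) (shifted g (r - degree g) c)"
        by (simp only: H' add.commute[of ?n ?m])
      finally show ?thesis using False by (simp add: sylvester_shifted potential_def)
    qed
  qed
  also have "\<dots> = lead_coeff p ^ degree g * lead_coeff q ^ degree f *
      part (weight (degree f) (degree g) F G H) (lresultant f g)"
    by (simp add: part_weight_lresultant[OF pol_f pol_g conv] lperm_scale_rows
        add.commute[of "degree f"] prod_if_less)
  finally show ?thesis .
qed

end

subsection \<open>Products of primary polynomials\<close>

text \<open>The invariant of the induction: the bound set by the potentials is attained, so by
  \<open>part_idem\<close> the maximal part is the whole resultant.\<close>

definition balanced :: "'g set \<Rightarrow> ('g::linordered_ab_group_add, 'l::{comm_semiring, monoid_mult}) layered poly
    \<Rightarrow> ('g, 'l) layered poly \<Rightarrow> bool" where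
  "balanced A f g \<longleftrightarrow> (\<exists>F G H. polygon A f F \<and> polygon A g G \<and>
     (\<forall>i\<le>degree f. \<forall>r\<le>degree g. F i + G r \<le> H (i + r)) \<and> H 0 = F 0 + G 0 \<and>
     part (weight (degree f) (degree g) F G H) (lresultant f g) \<noteq> 0)"

lemma homogeneous_1: "homogeneous a 1"
  by (simp add: homogeneous_def part_zero_1)

lemma balanced_1: "balanced {} 1 1"
  unfolding balanced_def
  by (rule exI[of _ "\<lambda>_. 0"])+
    (simp add: polygon_def weight_def lresultant_def lperm_def part_zero_1 val_le_zero_1)

text \<open>All factors in \<open>part_weight_mult\<close> are nonzero, hence so is the part on its
  left; both parts may then be replaced by the full resultants.\<close>

lemma balanced_mult:
  assumes bal: "balanced A f g" and a: "\<And>b. b \<in> A \<Longrightarrow> a < b"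
    and hom: "homogeneous a p" "homogeneous a q"
  shows "balanced (insert a A) (p * f) (q * g)" (is ?bal)
    and "lresultant (p * f) (q * g) =
      coeff f 0 ^ degree q * coeff g 0 ^ degree p * lresultant p q *
      (lead_coeff p ^ degree g * lead_coeff q ^ degree f * lresultant f g)" (is ?res)
proof -
  from bal obtain F G H where FGH: "polygon A f F" "polygon A g G"
      "\<And>i r. i \<le> degree f \<Longrightarrow> r \<le> degree g \<Longrightarrow> F i + G r \<le> H (i + r)" "H 0 = F 0 + G 0"
    and nz: "part (weight (degree f) (degree g) F G H) (lresultant f g) \<noteq> 0"
    unfolding balanced_def by blast
  interpret peel a A p q f g F G H
    using FGH a hom by unfold_locales auto
  interpret s: peel a A q p g f G F H by (rule swap)
  let ?w = "weight (degree p + degree f) (degree q + degree g) F' G' H'"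
  have "coeff f 0 \<noteq> 0" "coeff g 0 \<noteq> 0" "p \<noteq> 0" "q \<noteq> 0" "coeff p 0 \<noteq> 0"
    using FGH hom by (auto simp: polygon_def homogeneous_def)
  then have nz': "part ?w (lresultant (p * f) (q * g)) \<noteq> 0"
    using nz unfolding part_weight_mult by (simp add: lresultant_nonzero)
  have "H' 0 = F' 0 + G' 0"
    using extend_conv_eq[of 0 0] by simp
  then show ?bal
    unfolding balanced_def
    using nz' extend_conv polygon_mult[OF hom_p pol_f a_less] polygon_mult[OF hom_q pol_g a_less]
    by (intro exI[of _ F'] exI[of _ G'] exI[of _ H']) (simp add: degree_pf s.degree_pf)
  show ?res
    using part_weight_mult part_idem[OF nz] part_idem[OF nz'] by simp
qed

lemma lperm_one: "lperm N (\<lambda>r c. if r = c then 1 else 0) = (1 :: 'a::comm_semiring_1)"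
proof (induction N)
  case (Suc N)
  then show ?case
    using lperm_lower_block[of N 1 "\<lambda>r c. if r = c then 1 else (0 :: 'a)"]
    by (simp add: lperm_def[of "Suc 0"] lessThan_Suc)
qed (simp add: lperm_def)

lemma lresultant_1_left: "lresultant 1 g = 1"
proof -
  have "lresultant 1 g = lperm (degree g) (\<lambda>r c. if r = c then 1 else 0)"
    unfolding lresultant_def by (simp, rule lperm_cong) (auto simp: sylvester_def)
  then show ?thesis by (simp add: lperm_one)
qed

lemma lresultant_1_right: "lresultant f 1 = 1"
  by (simp add: lresultant_commute[of f] lresultant_1_left)

text \<open>Two steps in which one of the new factors is \<open>1\<close>: first \<open>q\<close>
  enters with the root \<open>b\<close>, then \<open>p\<close> with the smaller root
  \<open>a\<close>.\<close>

lemma lresultant_homogeneous_less: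
  assumes "homogeneous a p" "homogeneous b q" "a < b"
  shows "lresultant p q = lead_coeff p ^ degree q * coeff q 0 ^ degree p"
proof -
  have "balanced {b} 1 q"
    using balanced_mult(1)[OF balanced_1 _ homogeneous_1 assms(2)] by simp
  from balanced_mult(2)[OF this _ assms(1) homogeneous_1] show ?thesis
    using assms(3) by (simp add: lresultant_1_left lresultant_1_right mult.commute)
qed

text \<open>Identifies the powers of leading and constant coefficients in
  \<open>balanced_mult\<close> as the resultants of factors with different roots.\<close>

lemma prod_lresultant_homogeneous_less:
  assumes "finite A" "homogeneous a p" "\<And>b. b \<in> A \<Longrightarrow> homogeneous b (q b) \<and> a < b"
  shows "(\<Prod>b\<in>A. lresultant p (q b)) =
    lead_coeff p ^ degree (\<Prod>b\<in>A. q b) * coeff (\<Prod>b\<in>A. q b) 0 ^ degree p"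
  using assms
proof (induction A)
  case (insert b A)
  have "q x \<noteq> 0" if "x \<in> insert b A" for x
    using insert.prems(2)[OF that] homogeneous_nonzero by blast
  then have "(\<Prod>b\<in>A. q b) \<noteq> 0" "q b \<noteq> 0"
    by (auto intro!: prod_nonzero)
  then show ?case
    using insert lresultant_homogeneous_less[of a p b "q b"]
    by (simp add: degree_mult_eq coeff_mult_0 power_add power_mult_distrib ac_simps)
qed simp

text \<open>The induction inserts an element below all earlier ones, as \<open>balanced_mult\<close>
  demands, and carries \<open>balanced\<close> along for its next step.\<close>

lemma lresultant_prod_homogeneous:
  assumes "finite A" "\<And>a. a \<in> A \<Longrightarrow> homogeneous a (p a) \<and> homogeneous a (q a)"
  shows "balanced A (\<Prod>a\<in>A. p a) (\<Prod>a\<in>A. q a) \<and>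
    lresultant (\<Prod>a\<in>A. p a) (\<Prod>a\<in>A. q a) = (\<Prod>a\<in>A. \<Prod>b\<in>A. lresultant (p a) (q b))"
  using assms
proof (induction A rule: finite_linorder_min_induct)
  case (insert a A)
  let ?f = "\<Prod>a\<in>A. p a" and ?g = "\<Prod>a\<in>A. q a"
  have hom: "homogeneous a (p a)" "homogeneous a (q a)" and "a \<notin> A"
    and IH: "balanced A ?f ?g" "lresultant ?f ?g = (\<Prod>a\<in>A. \<Prod>b\<in>A. lresultant (p a) (q b))"
    and less: "\<And>b. b \<in> A \<Longrightarrow> a < b"
    using insert by auto
  note step = balanced_mult[OF IH(1) less hom]
  have "(\<Prod>b\<in>A. lresultant (p a) (q b)) = lead_coeff (p a) ^ degree ?g * coeff ?g 0 ^ degree (p a)"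
    using insert hom by (intro prod_lresultant_homogeneous_less) auto
  moreover have "(\<Prod>b\<in>A. lresultant (p b) (q a)) = lead_coeff (q a) ^ degree ?f * coeff ?f 0 ^ degree (q a)"
    unfolding lresultant_commute[of _ "q a"]
    using insert hom by (intro prod_lresultant_homogeneous_less) auto
  ultimately show ?case
    using step IH(2) \<open>finite A\<close> \<open>a \<notin> A\<close> by (simp add: prod.distrib ac_simps)
qed (simp add: balanced_1 lresultant_1_left)

section \<open>Splitting off powers of the variable\<close>

lemma prod_monom_mult:
  "(\<Prod>x\<in>A. monom 1 (k x) * h x) = monom 1 (\<Sum>x\<in>A. k x) * (\<Prod>x\<in>A. h x)"
  for h :: "'a \<Rightarrow> 'b::comm_semiring_1 poly"
proof (induction A rule: infinite_finite_induct)
  case (insert x A)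
  then show ?case
    using mult_monom[of "1 :: 'b" "k x" 1 "\<Sum>x\<in>A. k x"] by (simp add: ac_simps)
qed auto

lemma coeff_0_prod: "coeff (\<Prod>x\<in>A. h x) 0 = (\<Prod>x\<in>A. coeff (h x) 0)"
  for h :: "'a \<Rightarrow> 'b::comm_semiring_1 poly"
  by (induction A rule: infinite_finite_induct) (auto simp: coeff_mult_0)

text \<open>Powers of the variable in the left argument multiply both sides by the same powers of
  the constant terms of the \<open>q y\<close>.\<close>

lemma lresultant_prod_monom_mult:
  fixes h :: "'a \<Rightarrow> 'b::{comm_semiring_1, semiring_no_zero_divisors} poly"
  assumes nz: "\<And>x. x \<in> A \<Longrightarrow> h x \<noteq> 0"
    and eq: "lresultant (\<Prod>x\<in>A. h x) (\<Prod>y\<in>B. q y) = (\<Prod>x\<in>A. \<Prod>y\<in>B. lresultant (h x) (q y))"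
  shows "lresultant (\<Prod>x\<in>A. monom 1 (k x) * h x) (\<Prod>y\<in>B. q y) =
    (\<Prod>x\<in>A. \<Prod>y\<in>B. lresultant (monom 1 (k x) * h x) (q y))"
proof -
  have "(\<Prod>x\<in>A. h x) \<noteq> 0" using nz by (rule prod_nonzero)
  then have "lresultant (\<Prod>x\<in>A. monom 1 (k x) * h x) (\<Prod>y\<in>B. q y) =
      (\<Prod>x\<in>A. \<Prod>y\<in>B. coeff (q y) 0 ^ k x * lresultant (h x) (q y))"
    unfolding prod_monom_mult
    by (simp add: lresultant_monom_left eq coeff_0_prod power_sum prod_power_distrib prod.distrib)
  then show ?thesis using nz by (simp add: lresultant_monom_left)
qed

lemma lresultant_prod:
  assumes fin: "finite A"
    and p: "\<And>a. a \<in> A \<Longrightarrow> \<exists>k h. p a = monom 1 k * h \<and> homogeneous a h"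
    and q: "\<And>a. a \<in> A \<Longrightarrow> \<exists>k h. q a = monom 1 k * h \<and> homogeneous a h"
  shows "lresultant (\<Prod>a\<in>A. p a) (\<Prod>a\<in>A. q a) = (\<Prod>a\<in>A. \<Prod>b\<in>A. lresultant (p a) (q b))"
proof -
  obtain kp hp where p': "\<And>a. a \<in> A \<Longrightarrow> p a = monom 1 (kp a) * hp a \<and> homogeneous a (hp a)"
    using p by metis
  obtain kq hq where q': "\<And>a. a \<in> A \<Longrightarrow> q a = monom 1 (kq a) * hq a \<and> homogeneous a (hq a)"
    using q by metis
  have nz: "hp a \<noteq> 0" "hq a \<noteq> 0" if "a \<in> A" for a
    using p'[OF that] q'[OF that] by (auto dest: homogeneous_nonzero)
  \<comment> \<open>Powers are restored in the left argument only: first for \<open>q\<close>, then,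
    after the arguments are exchanged, for \<open>p\<close>.\<close>
  have "lresultant (\<Prod>a\<in>A. hq a) (\<Prod>a\<in>A. hp a) = (\<Prod>a\<in>A. \<Prod>b\<in>A. lresultant (hq a) (hp b))"
    using lresultant_prod_homogeneous[OF fin, of hq hp] p' q' by blast
  then have "lresultant (\<Prod>a\<in>A. q a) (\<Prod>a\<in>A. hp a) = (\<Prod>a\<in>A. \<Prod>b\<in>A. lresultant (q a) (hp b))"
    using lresultant_prod_monom_mult[of A hq hp A kq] nz q' by simp
  then have "lresultant (\<Prod>a\<in>A. hp a) (\<Prod>a\<in>A. q a) = (\<Prod>a\<in>A. \<Prod>b\<in>A. lresultant (hp a) (q b))"
    unfolding lresultant_commute[of _ "hp _"] lresultant_commute[of _ "\<Prod>a\<in>A. hp a"]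
    by (subst prod.swap)
  then show ?thesis
    using lresultant_prod_monom_mult[of A hp q A kp] nz p' by simp
qed

text \<open>A primary polynomial may be divisible by the variable, so its homogeneous part has to be split off.\<close>

lemma poly_monom_factor:
  fixes f :: "'a::comm_semiring_1 poly"
  assumes "f \<noteq> 0"
  obtains k h where "f = monom 1 k * h" "coeff h 0 \<noteq> 0"
proof -
  have "\<exists>k h. f = monom 1 k * h \<and> coeff h 0 \<noteq> 0"
    using assms
  proof (induction f rule: pCons_induct)
    case (pCons a f)
    show ?case
    proof (cases "a = 0")
      case True
      then obtain k h where "f = monom 1 k * h" "coeff h 0 \<noteq> 0"
        using pCons by auto
      then show ?thesis
        using True by (intro exI[of _ "Suc k"] exI[of _ h]) (simp add: monom_Suc)
    next
      case False
      then show ?thesis by (intro exI[of _ 0] exI[of _ "pCons a f"]) simp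
    qed
  qed simp
  then show ?thesis using that by blast
qed

lemma Lay_power: "\<exists>l'. Lay x l ^ n = Lay (nmul n x) l'"
  by (induction n) (auto simp: one_layered_def)

lemma part_if_nu_eq: "nu_eq y (Lay v l) \<Longrightarrow> part v y = y"
  by (cases y) auto

text \<open>Dividing by a power of the variable lowers index and degree alike, so the value
  prescribed for each coefficient stays the same.\<close>

lemma primary_imp_homogeneous:
  assumes prim: "primary (Lay x l) f"
  shows "\<exists>k h. f = monom 1 k * h \<and> homogeneous x h"
proof -
  have "f \<noteq> 0"
    using prim by (auto simp: primary_def monic_def zero_layered_def one_layered_def)
  then obtain k h where f: "f = monom 1 k * h" and h: "coeff h 0 \<noteq> 0"
    by (rule poly_monom_factor)
  have "h \<noteq> 0" using h by auto
  then have deg: "degree f = k + degree h"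
    by (simp add: f degree_mult_eq degree_monom_eq)
  have "part (nmul (degree h - i) x) (coeff h i) = coeff h i" if "i \<le> degree h" for i
  proof (cases "coeff h i = 0")
    case False
    have "coeff f (k + i) = coeff h i" by (simp add: f coeff_monom_mult)
    then have "nu_eq (coeff h i) (Lay x l ^ (degree h - i))"
      using prim that False unfolding primary_def deg
      by (metis add_diff_cancel_left add_le_cancel_left)
    then show ?thesis
      using Lay_power[of x l "degree h - i"] part_if_nu_eq by metis
  qed simp
  then show ?thesis using f h by (auto simp: homogeneous_def)
qed

section \<open>From lists of primary factors to products indexed by values\<close>

lemma prod_list_map_of:
  assumes "distinct (map fst M)" "finite A" "fst ` set M \<subseteq> A" "\<phi> d = (1 :: 'c::comm_monoid_mult)"
  shows "prod_list (map (\<lambda>m. \<phi> (snd m)) M) =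
    (\<Prod>x\<in>A. \<phi> (case map_of M x of None \<Rightarrow> d | Some f \<Rightarrow> f))"
  using assms
proof (induction M arbitrary: A)
  case (Cons m M)
  have "fst ` set M \<subseteq> A - {fst m}"
    using Cons.prems(1,3) unfolding list.set list.map distinct.simps set_map by blast
  then have "prod_list (map (\<lambda>m. \<phi> (snd m)) M) =
      (\<Prod>x\<in>A - {fst m}. \<phi> (case map_of M x of None \<Rightarrow> d | Some f \<Rightarrow> f))"
    using Cons.prems by (intro Cons.IH) auto
  also have "\<dots> = (\<Prod>x\<in>A - {fst m}. \<phi> (case map_of (m # M) x of None \<Rightarrow> d | Some f \<Rightarrow> f))"
    by (intro prod.cong) (auto simp: fun_upd_def)
  finally show ?case
    using Cons.prems prod.remove[of A "fst m" "\<lambda>x. \<phi> (case map_of (m # M) x of None \<Rightarrow> d | Some f \<Rightarrow> f)"]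
    by simp
qed simp

fun val :: "('g, 'l) layered \<Rightarrow> 'g" where
  "val (Lay x k) = x"
| "val LZero = undefined"

text \<open>Values missing from the list get the factor \<open>1\<close>, which is homogeneous for
  every value, so two decompositions can share one index set.\<close>

definition component :: "(('g, 'l) layered \<times> 'p::one) list \<Rightarrow> 'g \<Rightarrow> 'p" where
  "component D x = (case map_of (map (\<lambda>(a, f). (val a, f)) D) x of None \<Rightarrow> 1 | Some f \<Rightarrow> f)"

lemma component_homogeneous:
  assumes "primary_decomposition f D"
  shows "\<exists>k h. component D x = monom 1 k * h \<and> homogeneous x h"
proof (cases "map_of (map (\<lambda>(a, f). (val a, f)) D) x")
  case None
  then show ?thesis
    using homogeneous_1 by (intro exI[of _ 0] exI[of _ 1]) (simp add: component_def)
next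
  case (Some p)
  then obtain a where a: "(a, p) \<in> set D" "val a = x"
    by (auto dest!: map_of_SomeD)
  then have "a \<noteq> 0" "primary a p"
    using assms by (auto simp: primary_decomposition_def)
  then show ?thesis
    using a(2) Some primary_imp_homogeneous by (cases a) (auto simp: component_def zero_layered_def)
qed

text \<open>The map \<open>\<phi>\<close> is general because the same reindexing serves the
  polynomial itself and both products of resultants.\<close>

lemma prod_component:
  assumes dec: "primary_decomposition f D" and fin: "finite A" and sub: "(val \<circ> fst) ` set D \<subseteq> A"
    and one: "\<phi> 1 = (1 :: 'c::comm_monoid_mult)"
  shows "(\<Prod>(a, p)\<leftarrow>D. \<phi> p) = (\<Prod>x\<in>A. \<phi> (component D x))"
proof -
  let ?M = "map (\<lambda>(a, f). (val a, f)) D"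
  have "distinct (map fst ?M)"
    unfolding distinct_conv_nth
  proof (intro allI impI)
    fix i j assume ij: "i < length (map fst ?M)" "j < length (map fst ?M)" "i \<noteq> j"
    then have "D ! i \<in> set D" "D ! j \<in> set D" "\<not> nu_eq (fst (D ! i)) (fst (D ! j))"
      using dec by (auto simp: primary_decomposition_def)
    moreover from this have "fst (D ! i) \<noteq> 0" "fst (D ! j) \<noteq> 0"
      using dec by (auto simp: primary_decomposition_def)
    \<comment> \<open>Between nonzero elements \<open>nu_eq\<close> is equality of
      \<open>val\<close>.\<close>
    ultimately have "val (fst (D ! i)) \<noteq> val (fst (D ! j))"
      by (cases "fst (D ! i)"; cases "fst (D ! j)") (auto simp: zero_layered_def)
    then show "map fst ?M ! i \<noteq> map fst ?M ! j"
      using ij by (simp add: case_prod_beta)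
  qed
  moreover have "fst ` set ?M \<subseteq> A" using sub by (auto simp: image_iff)
  ultimately have "prod_list (map (\<lambda>m. \<phi> (snd m)) ?M) = (\<Prod>x\<in>A. \<phi> (component D x))"
    unfolding component_def using fin one by (intro prod_list_map_of)
  then show ?thesis by (simp add: o_def case_prod_unfold)
qed

theorem theorem8p33:
  fixes f g :: "('g::linordered_ab_group_add, 'l::{comm_semiring, monoid_mult, linorder}) layered poly"
    and Df Dg :: "(('g, 'l) layered \<times> ('g, 'l) layered poly) list"
  assumes L_ord_add: "\<forall>x y z::'l. x \<le> y \<longrightarrow> x + z \<le> y + z"
    and L_ord_mult: "\<forall>x y z::'l. x \<le> y \<longrightarrow> x * z \<le> y * z"
    and "monic f" and "monic g"
    and "primary_decomposition f Df" and "primary_decomposition g Dg"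
  shows "lresultant f g =
           (\<Prod>(a, fa) \<leftarrow> Df. \<Prod>(b, gb) \<leftarrow> Dg. lresultant fa gb)"
proof -
  \<comment> \<open>A common index set: the values of the roots of either polynomial.\<close>
  define A where "A = (val \<circ> fst) ` set Df \<union> (val \<circ> fst) ` set Dg"
  have A: "finite A" "(val \<circ> fst) ` set Df \<subseteq> A" "(val \<circ> fst) ` set Dg \<subseteq> A"
    by (auto simp: A_def)
  note f = prod_component[OF assms(5) A(1,2)] and g = prod_component[OF assms(6) A(1,3)]
  have "f = (\<Prod>x\<in>A. component Df x)" "g = (\<Prod>x\<in>A. component Dg x)"
    using f[of "\<lambda>p. p"] g[of "\<lambda>p. p"] assms(5,6)
    by (auto simp: primary_decomposition_def case_prod_unfold)
  then have "lresultant f g =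
      (\<Prod>x\<in>A. \<Prod>y\<in>A. lresultant (component Df x) (component Dg y))"
    using lresultant_prod[OF A(1) component_homogeneous[OF assms(5)] component_homogeneous[OF assms(6)]]
    by simp
  also have "\<dots> = (\<Prod>x\<in>A. \<Prod>(b, gb)\<leftarrow>Dg. lresultant (component Df x) gb)"
    by (simp add: g lresultant_1_right)
  also have "\<dots> = (\<Prod>(a, fa)\<leftarrow>Df. \<Prod>(b, gb)\<leftarrow>Dg. lresultant fa gb)"
    by (subst f[of "\<lambda>fa. \<Prod>(b, gb)\<leftarrow>Dg. lresultant fa gb"])
      (simp_all add: g[of "lresultant 1"] lresultant_1_right lresultant_1_left)
  finally show ?thesis .
qed

end
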